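(* Let $X$ be a compact metrisable space and $\sigma:X\to X$ a homeomorphism, generating a $\mathbb Z$-action, with Ellis semigroup $E(X)$. Suppose that forward proximality agrees with forward asymptoticity and that backward proximality agrees with backward asymptoticity. Then $E(X)$ is completely regular. If moreover the forward and the backward proximality relations are both non-trivial (i.e. not equal to the diagonal), then $E(X)$ is the disjoint union of its kernel $\mathcal M(X)$ with the acting group $\{\sigma^t : t\in\mathbb Z\}$.
   Context: The Ellis semigroup $E(X)$ is the closure of $\{\sigma^t: t\in\mathbb Z\}$ in $X^X$ for the topology of pointwise convergence, a semigroup under composition. Let $d$ be a metric inducing the topology of $X$. Points $x,x'$ are forward proximal if $\inf_{t\in\mathbb Z^+} d(\sigma^t(x),\sigma^t(x'))=0$ and forward asymptotic if $\lim_{t\to+\infty} d(\sigma^t(x),\sigma^t(x'))=0$; backward proximality and asymptoticity are defined in the same way using $\sigma^{-1}$ in place of $\sigma$. A semigroup $S$ is completely regular if every $s\in S$ has a normal inverse, i.e. some $t\in S$ with $sts=s$, $tst=t$, $st=ts$. The kernel $\mathcal M(X)$ of $E(X)$ is its smallest two-sided ideal (which exists since $E(X)$ is a compact right-topological semigroup). *)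

theory Defs
  imports "HOL-Analysis.Analysis"
begin

section \<open>Semigroups with an explicit carrier\<close>

definition semigroup_on :: "'s set \<Rightarrow> ('s \<Rightarrow> 's \<Rightarrow> 's) \<Rightarrow> bool" where
  "semigroup_on S m \<longleftrightarrow>
     (\<forall>s\<in>S. \<forall>t\<in>S. m s t \<in> S) \<and>
     (\<forall>s\<in>S. \<forall>t\<in>S. \<forall>u\<in>S. m (m s t) u = m s (m t u))"

definition normal_inverse :: "('s \<Rightarrow> 's \<Rightarrow> 's) \<Rightarrow> 's \<Rightarrow> 's \<Rightarrow> bool" where
  "normal_inverse m s t \<longleftrightarrow> m (m s t) s = s \<and> m (m t s) t = t \<and> m s t = m t s"

definition completely_regular :: "'s set \<Rightarrow> ('s \<Rightarrow> 's \<Rightarrow> 's) \<Rightarrow> bool" where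
  "completely_regular S m \<longleftrightarrow> semigroup_on S m \<and> (\<forall>s\<in>S. \<exists>t\<in>S. normal_inverse m s t)"

definition two_sided_ideal :: "'s set \<Rightarrow> ('s \<Rightarrow> 's \<Rightarrow> 's) \<Rightarrow> 's set \<Rightarrow> bool" where
  "two_sided_ideal S m I \<longleftrightarrow>
     I \<noteq> {} \<and> I \<subseteq> S \<and> (\<forall>s\<in>S. \<forall>i\<in>I. m s i \<in> I \<and> m i s \<in> I)"

text \<open>The order on sets is inclusion, so the following is the smallest two-sided ideal. It is
  only meaningful if there is one; for Ellis semigroups this is proved at the end of this theory.\<close>

definition semigroup_kernel :: "'s set \<Rightarrow> ('s \<Rightarrow> 's \<Rightarrow> 's) \<Rightarrow> 's set" where
  "semigroup_kernel S m = (LEAST I. two_sided_ideal S m I)"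

section \<open>Ellis semigroup, proximality and asymptoticity\<close>

definition int_iterate :: "('a \<Rightarrow> 'a) \<Rightarrow> int \<Rightarrow> 'a \<Rightarrow> 'a" where
  "int_iterate \<sigma> t = (if t \<ge> 0 then \<sigma> ^^ nat t else inv \<sigma> ^^ nat (- t))"

definition acting_group :: "('a \<Rightarrow> 'a) \<Rightarrow> ('a \<Rightarrow> 'a) set" where
  "acting_group \<sigma> = range (int_iterate \<sigma>)"

text \<open>The topology on \<open>'a \<Rightarrow> 'a\<close> is the library's product topology, that is, the topology of
  pointwise convergence.\<close>

definition ellis :: "('a::topological_space \<Rightarrow> 'a) \<Rightarrow> ('a \<Rightarrow> 'a) set" where
  "ellis \<sigma> = closure (acting_group \<sigma>)"

definition forward_proximal :: "('a::metric_space \<Rightarrow> 'a) \<Rightarrow> ('a \<times> 'a) set" where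
  "forward_proximal \<sigma> = {(x, x'). (INF t::nat. dist ((\<sigma> ^^ t) x) ((\<sigma> ^^ t) x')) = 0}"

definition forward_asymptotic :: "('a::metric_space \<Rightarrow> 'a) \<Rightarrow> ('a \<times> 'a) set" where
  "forward_asymptotic \<sigma> = {(x, x'). (\<lambda>t. dist ((\<sigma> ^^ t) x) ((\<sigma> ^^ t) x')) \<longlonglongrightarrow> 0}"

definition backward_proximal :: "('a::metric_space \<Rightarrow> 'a) \<Rightarrow> ('a \<times> 'a) set" where
  "backward_proximal \<sigma> = forward_proximal (inv \<sigma>)"

definition backward_asymptotic :: "('a::metric_space \<Rightarrow> 'a) \<Rightarrow> ('a \<times> 'a) set" where
  "backward_asymptotic \<sigma> = forward_asymptotic (inv \<sigma>)"

section \<open>The Ellis semigroup is a semigroup and has a smallest two-sided ideal\<close>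

lemma int_iterate_succ:
  assumes "bij \<sigma>"
  shows "\<sigma> \<circ> int_iterate \<sigma> t = int_iterate \<sigma> (t + 1)"
proof (cases "t \<ge> 0")
  case True
  then have "nat (t + 1) = Suc (nat t)" by simp
  with True show ?thesis by (simp add: int_iterate_def)
next
  case False
  define k where "k = nat (- (t + 1))"
  have k: "nat (- t) = Suc k" "nat (- (t + 1)) = k"
    using False by (simp_all add: k_def)
  have "\<sigma> \<circ> (inv \<sigma> ^^ Suc k) = inv \<sigma> ^^ k"
    using assms by (simp add: fun_eq_iff bij_is_surj surj_f_inv_f)
  moreover have "t + 1 \<ge> 0 \<Longrightarrow> k = 0 \<and> t + 1 = 0" using False k by simp
  ultimately show ?thesis using False k by (auto simp: int_iterate_def)
qed

lemma int_iterate_pred: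
  assumes "bij \<sigma>"
  shows "inv \<sigma> \<circ> int_iterate \<sigma> t = int_iterate \<sigma> (t - 1)"
proof -
  have "inv \<sigma> \<circ> (\<sigma> \<circ> int_iterate \<sigma> (t - 1)) = int_iterate \<sigma> (t - 1)"
    using assms by (simp add: fun_eq_iff bij_is_inj)
  then show ?thesis using int_iterate_succ[OF assms, of "t - 1"] by simp
qed

lemma int_iterate_add:
  assumes "bij \<sigma>"
  shows "int_iterate \<sigma> (s + t) = int_iterate \<sigma> s \<circ> int_iterate \<sigma> t"
proof (induction s rule: int_induct[where k = 0])
  case base
  show ?case by (simp add: int_iterate_def)
next
  case (step1 i)
  have "int_iterate \<sigma> (i + 1 + t) = \<sigma> \<circ> int_iterate \<sigma> (i + t)"
    by (simp add: int_iterate_succ[OF assms] algebra_simps)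
  also have "\<dots> = int_iterate \<sigma> (i + 1) \<circ> int_iterate \<sigma> t"
    unfolding step1.IH int_iterate_succ[OF assms, symmetric] by (simp add: comp_assoc)
  finally show ?case .
next
  case (step2 i)
  have "int_iterate \<sigma> (i - 1 + t) = inv \<sigma> \<circ> int_iterate \<sigma> (i + t)"
    by (simp add: int_iterate_pred[OF assms] algebra_simps)
  also have "\<dots> = int_iterate \<sigma> (i - 1) \<circ> int_iterate \<sigma> t"
    unfolding step2.IH int_iterate_pred[OF assms, symmetric] by (simp add: comp_assoc)
  finally show ?case .
qed

lemma continuous_on_funpow:
  assumes "continuous_on UNIV (f :: 'a::topological_space \<Rightarrow> 'a)"
  shows "continuous_on UNIV (f ^^ n)"
proof (induction n)
  case 0
  show ?case by (simp add: id_def)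
next
  case (Suc n)
  then show ?case
    using continuous_on_compose[OF Suc continuous_on_subset[OF assms subset_UNIV]] by simp
qed

lemma continuous_on_int_iterate:
  assumes "homeomorphism UNIV UNIV \<sigma> (inv \<sigma>)"
  shows "continuous_on UNIV (int_iterate \<sigma> t)"
  using assms by (auto simp: int_iterate_def homeomorphism_def intro: continuous_on_funpow)

lemma homeomorphism_UNIV_bij:
  assumes "homeomorphism UNIV UNIV \<sigma> (inv \<sigma>)"
  shows "bij \<sigma>"
  using assms unfolding homeomorphism_def by (metis UNIV_I bijI injI)

lemma continuous_on_comp_right:
  "continuous_on A (\<lambda>f :: 'a \<Rightarrow> 'b::topological_space. f \<circ> g)"
  by (rule continuous_on_coordinatewise_then_product)
    (auto intro: continuous_on_subset[OF continuous_on_product_coordinates])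

lemma continuous_on_comp_left:
  assumes "continuous_on UNIV h"
  shows "continuous_on A (\<lambda>f :: 'a \<Rightarrow> 'b::topological_space. h \<circ> f)"
proof (rule continuous_on_coordinatewise_then_product)
  fix i
  have "continuous_on A (\<lambda>f :: 'a \<Rightarrow> 'b. f i)"
    by (rule continuous_on_subset[OF continuous_on_product_coordinates]) simp
  then show "continuous_on A (\<lambda>f. (h \<circ> f) i)"
    using continuous_on_compose2[OF assms] by simp
qed

lemma ellis_comp_closed:
  assumes "homeomorphism UNIV UNIV \<sigma> (inv \<sigma>)" "f \<in> ellis \<sigma>" "g \<in> ellis \<sigma>"
  shows "f \<circ> g \<in> ellis \<sigma>"
proof -
  note bij = homeomorphism_UNIV_bij[OF assms(1)]
  have 1: "int_iterate \<sigma> s \<circ> g \<in> ellis \<sigma>" for s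
  proof -
    have "(\<lambda>g. int_iterate \<sigma> s \<circ> g) ` closure (acting_group \<sigma>) \<subseteq> closure (acting_group \<sigma>)"
    proof (rule image_closure_subset)
      show "(\<lambda>g. int_iterate \<sigma> s \<circ> g) ` acting_group \<sigma> \<subseteq> closure (acting_group \<sigma>)"
        using closure_subset[of "acting_group \<sigma>"]
        by (auto simp: acting_group_def int_iterate_add[OF bij, symmetric])
    qed (auto intro: continuous_on_comp_left continuous_on_int_iterate[OF assms(1)])
    then show ?thesis using assms(3) by (auto simp: ellis_def)
  qed
  have "(\<lambda>f. f \<circ> g) ` closure (acting_group \<sigma>) \<subseteq> ellis \<sigma>"
  proof (rule image_closure_subset)
    show "(\<lambda>f. f \<circ> g) ` acting_group \<sigma> \<subseteq> ellis \<sigma>"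
      using 1 by (auto simp: acting_group_def)
  qed (auto simp: ellis_def continuous_on_comp_right)
  then show ?thesis using assms(2) by (auto simp: ellis_def)
qed

lemma ellis_semigroup:
  assumes "homeomorphism UNIV UNIV \<sigma> (inv \<sigma>)"
  shows "semigroup_on (ellis \<sigma>) (\<circ>)"
  using ellis_comp_closed[OF assms] by (auto simp: semigroup_on_def comp_assoc)

lemma compact_UNIV_fun:
  assumes "compact (UNIV :: 'b::topological_space set)"
  shows "compact (UNIV :: ('a \<Rightarrow> 'b) set)"
proof -
  have "compact_space (euclidean :: 'b topology)"
    using assms by (simp add: compact_space_def)
  then have "compact_space (product_topology (\<lambda>_::'a. euclidean :: 'b topology) UNIV)"
    by (simp add: compact_space_product_topology)
  then show ?thesis by (simp add: euclidean_product_topology compact_space_def)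
qed

lemma compact_imp_closed_fun:
  assumes "compact (A :: ('a \<Rightarrow> 'b::metric_space) set)"
  shows "closed A"
proof -
  have "Hausdorff_space (product_topology (\<lambda>_::'a. euclidean :: 'b topology) UNIV)"
    by (simp add: Hausdorff_space_product_topology)
  then have "Hausdorff_space (euclidean :: ('a \<Rightarrow> 'b) topology)"
    by (simp add: euclidean_product_topology)
  with assms show ?thesis
    using compactin_imp_closedin[of euclidean A] by simp
qed

lemma compact_ellis:
  assumes "compact (UNIV :: 'a::metric_space set)"
  shows "compact (ellis (\<sigma> :: 'a \<Rightarrow> 'a))"
  using compact_Int_closed[OF compact_UNIV_fun[OF assms], of "ellis \<sigma>"]
  by (simp add: ellis_def)

lemma ellis_minimal_left_ideal:
  fixes \<sigma> :: "'a::metric_space \<Rightarrow> 'a"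
  assumes "compact (UNIV :: 'a set)" "homeomorphism UNIV UNIV \<sigma> (inv \<sigma>)"
  obtains L where "L \<noteq> {}" "L \<subseteq> ellis \<sigma>" "\<And>f. f \<in> L \<Longrightarrow> (\<lambda>g. g \<circ> f) ` ellis \<sigma> = L"
proof -
  let ?E = "ellis \<sigma>"
  define P where
    "P L \<longleftrightarrow> closed L \<and> L \<noteq> {} \<and> L \<subseteq> ?E \<and> (\<forall>s\<in>?E. \<forall>f\<in>L. s \<circ> f \<in> L)" for L
  note cl = ellis_comp_closed[OF assms(2)]
  have "\<exists>id. id \<in> acting_group \<sigma>" by (auto simp: acting_group_def)
  then have ne: "?E \<noteq> {}" using closure_subset[of "acting_group \<sigma>"] by (auto simp: ellis_def)
  have PE: "P ?E" using cl ne by (auto simp: P_def ellis_def)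
  define \<A> where "\<A> = {- L | L. P L}"
  have "\<exists>M\<in>\<A>. \<forall>X\<in>\<A>. M \<subseteq> X \<longrightarrow> X = M"
  proof (rule subset_Zorn_nonempty)
    show "\<A> \<noteq> {}" using PE by (auto simp: \<A>_def)
  next
    fix \<C> assume C: "\<C> \<noteq> {}" "subset.chain \<A> \<C>"
    define \<D> where "\<D> = uminus ` \<C>"
    have D: "P L" if "L \<in> \<D>" for L
      using that C(2) by (auto simp: \<D>_def \<A>_def subset.chain_def)
    have chain: "L \<subseteq> L' \<or> L' \<subseteq> L" if "L \<in> \<D>" "L' \<in> \<D>" for L L'
      using that C(2) by (auto simp: \<D>_def subset_chain_def)
    obtain L0 where L0: "L0 \<in> \<D>" using C(1) by (auto simp: \<D>_def)
    have min: "\<exists>L\<in>\<D>. L \<subseteq> \<Inter>F" if "finite F" "F \<noteq> {}" "F \<subseteq> \<D>" for F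
      using that
    proof (induction F rule: finite_ne_induct)
      case (singleton x)
      then show ?case by auto
    next
      case (insert x F)
      then obtain L where L: "L \<in> \<D>" "L \<subseteq> \<Inter>F" by auto
      show ?case
      proof (cases "L \<subseteq> x")
        case True
        then show ?thesis using L by auto
      next
        case False
        then have "x \<subseteq> L" using chain L insert.prems by auto
        then show ?thesis using L insert.prems by auto
      qed
    qed
    have "?E \<inter> \<Inter>\<D> \<noteq> {}"
    proof (rule compact_imp_fip[OF compact_ellis[OF assms(1)]])
      fix F assume F: "finite F" "F \<subseteq> \<D>"
      show "?E \<inter> \<Inter>F \<noteq> {}"
      proof (cases "F = {}")
        case True
        then show ?thesis using ne by simp
      next
        case False
        then obtain L where "L \<in> \<D>" "L \<subseteq> \<Inter>F" using min F by blast
        then show ?thesis using D[of L] unfolding P_def by blast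
      qed
    qed (use D in \<open>auto simp: P_def\<close>)
    then have "P (\<Inter>\<D>)"
      using D L0 unfolding P_def by (intro conjI closed_Inter) blast+
    moreover have "\<Union>\<C> = - \<Inter>\<D>" by (auto simp: \<D>_def)
    ultimately show "\<Union>\<C> \<in> \<A>" by (auto simp: \<A>_def)
  qed
  then obtain L where L: "P L" and "\<And>L'. P L' \<Longrightarrow> - L \<subseteq> - L' \<Longrightarrow> - L' = - L"
    by (auto simp: \<A>_def)
  then have minL: "L' = L" if "P L'" "L' \<subseteq> L" for L' using that by (metis Compl_subset_Compl_iff double_complement)
  have "(\<lambda>g. g \<circ> f) ` ?E = L" if f: "f \<in> L" for f
  proof (rule minL)
    have "compact ((\<lambda>g. g \<circ> f) ` ?E)"
      by (intro compact_continuous_image continuous_on_comp_right compact_ellis assms(1))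
    then have "closed ((\<lambda>g. g \<circ> f) ` ?E)" by (rule compact_imp_closed_fun)
    moreover have "s \<circ> (g \<circ> f) \<in> (\<lambda>g. g \<circ> f) ` ?E" if "s \<in> ?E" "g \<in> ?E" for s g
      using cl[OF that] by (auto simp: comp_assoc[symmetric])
    moreover have "f \<in> ?E" using f L by (auto simp: P_def)
    ultimately show "P ((\<lambda>g. g \<circ> f) ` ?E)"
      using ne cl by (auto simp: P_def)
    show "(\<lambda>g. g \<circ> f) ` ?E \<subseteq> L" using L f by (auto simp: P_def)
  qed
  then show ?thesis using L that by (auto simp: P_def)
qed

lemma ellis_kernel:
  fixes \<sigma> :: "'a::metric_space \<Rightarrow> 'a"
  assumes "compact (UNIV :: 'a set)" "homeomorphism UNIV UNIV \<sigma> (inv \<sigma>)"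
  shows "two_sided_ideal (ellis \<sigma>) (\<circ>) (semigroup_kernel (ellis \<sigma>) (\<circ>))"
    and "two_sided_ideal (ellis \<sigma>) (\<circ>) I \<Longrightarrow> semigroup_kernel (ellis \<sigma>) (\<circ>) \<subseteq> I"
proof -
  let ?E = "ellis \<sigma>"
  note cl = ellis_comp_closed[OF assms(2)]
  obtain L where L: "L \<noteq> {}" "L \<subseteq> ?E" "\<And>f. f \<in> L \<Longrightarrow> (\<lambda>g. g \<circ> f) ` ?E = L"
    using ellis_minimal_left_ideal[OF assms] by metis
  define K where "K = (\<Union>s\<in>?E. (\<lambda>f. f \<circ> s) ` L)"
  have left: "g \<circ> f \<in> L" if "g \<in> ?E" "f \<in> L" for f g using L(3) that by blast
  have K: "two_sided_ideal ?E (\<circ>) K"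
    unfolding two_sided_ideal_def
  proof (intro conjI ballI)
    have "?E \<noteq> {}" using L(1,2) by auto
    then show "K \<noteq> {}" using L(1) by (auto simp: K_def)
    show "K \<subseteq> ?E" using L(2) cl by (auto simp: K_def)
  next
    fix s i assume s: "s \<in> ?E" and "i \<in> K"
    then obtain f r where i: "f \<in> L" "r \<in> ?E" "i = f \<circ> r" by (auto simp: K_def)
    have "s \<circ> i = (s \<circ> f) \<circ> r" "i \<circ> s = f \<circ> (r \<circ> s)" by (simp_all add: i comp_assoc)
    then show "s \<circ> i \<in> K" "i \<circ> s \<in> K"
      using left[OF s i(1)] cl[OF i(2) s] i(1,2) unfolding K_def by blast+
  qed
  have least: "K \<subseteq> J" if J: "two_sided_ideal ?E (\<circ>) J" for J
  proof -
    obtain j where j: "j \<in> J" "j \<in> ?E" using J by (auto simp: two_sided_ideal_def)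
    have JE: "s \<circ> i \<in> J" "i \<circ> s \<in> J" if "s \<in> ?E" "i \<in> J" for s i
      using J that unfolding two_sided_ideal_def by blast+
    obtain f where f: "f \<in> L" using L(1) by auto
    then have "f \<in> ?E" using L(2) by auto
    then have "j \<circ> f \<in> J" using JE(2) j(1) by blast
    moreover have "L = (\<lambda>g. g \<circ> (j \<circ> f)) ` ?E" using L(3)[OF left[OF j(2) f]] by simp
    ultimately have "L \<subseteq> J" using JE(1) by blast
    then show ?thesis using JE(2) unfolding K_def by blast
  qed
  have "semigroup_kernel ?E (\<circ>) = K"
    unfolding semigroup_kernel_def using K least by (rule Least_equality)
  then show "two_sided_ideal ?E (\<circ>) (semigroup_kernel ?E (\<circ>))"
    and "two_sided_ideal ?E (\<circ>) I \<Longrightarrow> semigroup_kernel ?E (\<circ>) \<subseteq> I"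
    using K least by auto
qed

end

theory Submission
  imports Defs
begin

text \<open>Let \<open>L\<close> be the set of limits of \<open>\<sigma>\<^sup>t\<close> as \<open>t \<longrightarrow> +\<infinity>\<close>. It is a compact left ideal of the Ellis
  semigroup. An idempotent \<open>p \<in> L\<close> identifies \<open>x\<close> with \<open>p x\<close>, so these two points are forward
  proximal, hence forward asymptotic, hence identified by every element of \<open>L\<close>: thus \<open>f p = f\<close> for
  all \<open>f \<in> L\<close>. As every closed subsemigroup contains an idempotent, this makes \<open>L\<close> a minimal left
  ideal all of whose elements have normal inverses. The same holds for the limits as \<open>t \<longrightarrow> -\<infinity>\<close>, and
  together with the acting group the two limit sets exhaust the Ellis semigroup. If both
  proximality relations are non-trivial, no limit is injective, so that the union of the two limit
  sets is disjoint from the acting group; it is the kernel.\<close>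

section \<open>Compact semigroups of self-maps\<close>

text \<open>The Ellis--Numakura lemma.\<close>

lemma compact_semigroup_idempotent:
  fixes S :: "('a::metric_space \<Rightarrow> 'a) set"
  assumes "compact S" "S \<noteq> {}" "\<And>f g. f \<in> S \<Longrightarrow> g \<in> S \<Longrightarrow> f \<circ> g \<in> S"
  obtains p where "p \<in> S" "p \<circ> p = p"
proof -
  define \<A> where "\<A> = {A. closed A \<and> A \<noteq> {} \<and> A \<subseteq> S \<and> (\<forall>f\<in>A. \<forall>g\<in>A. f \<circ> g \<in> A)}"
  have S: "S \<in> \<A>"
    using assms by (auto simp: \<A>_def compact_imp_closed_fun)
  \<comment> \<open>Zorn for reverse inclusion: a minimal closed subsemigroup. A finite part of a
    chain has a smallest member, so compactness makes the intersection of the chain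
    nonempty.\<close>
  have "\<exists>A\<in>\<A>. \<forall>B\<in>\<A>. B \<subseteq> A \<longrightarrow> B = A"
  proof (rule predicate_Zorn)
    show "partial_order_on \<A> (relation_of (\<lambda>A B. B \<subseteq> A) \<A>)"
      by (rule partial_order_on_relation_ofI) auto
  next
    fix \<C> assume "\<C> \<in> Chains (relation_of (\<lambda>A B. B \<subseteq> A) \<A>)"
    then have sub: "\<C> \<subseteq> \<A>" and chain: "\<And>A B. A \<in> \<C> \<Longrightarrow> B \<in> \<C> \<Longrightarrow> B \<subseteq> A \<or> A \<subseteq> B"
      by (auto simp: Chains_def relation_of_def)
    show "\<exists>U\<in>\<A>. \<forall>A\<in>\<C>. U \<subseteq> A"
    proof (cases "\<C> = {}")
      case True
      then show ?thesis using S by auto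
    next
      case False
      have min: "\<exists>A\<in>\<C>. A \<subseteq> \<Inter>F" if "finite F" "F \<noteq> {}" "F \<subseteq> \<C>" for F
        using that
      proof (induction F rule: finite_ne_induct)
        case (singleton A)
        then show ?case by auto
      next
        case (insert B F)
        then obtain A where "A \<in> \<C>" "A \<subseteq> \<Inter>F" by auto
        then show ?case using chain[of A B] insert.prems by auto
      qed
      have "S \<inter> \<Inter>\<C> \<noteq> {}"
      proof (rule compact_imp_fip[OF assms(1)])
        fix F assume F: "finite F" "F \<subseteq> \<C>"
        show "S \<inter> \<Inter>F \<noteq> {}"
        proof (cases "F = {}")
          case True
          then show ?thesis using assms(2) by simp
        next
          case False
          then obtain A where "A \<in> \<C>" "A \<subseteq> \<Inter>F" using min F by blast
          then show ?thesis using sub unfolding \<A>_def by blast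
        qed
      qed (use sub in \<open>auto simp: \<A>_def\<close>)
      then have "\<Inter>\<C> \<in> \<A>"
        using sub False unfolding \<A>_def by (intro CollectI conjI closed_Inter) blast+
      then show ?thesis by blast
    qed
  qed
  then obtain A where A: "A \<in> \<A>" and min: "\<And>B. B \<in> \<A> \<Longrightarrow> B \<subseteq> A \<Longrightarrow> B = A" by blast
  then have "closed A" "A \<subseteq> S" and cl: "\<And>f g. f \<in> A \<Longrightarrow> g \<in> A \<Longrightarrow> f \<circ> g \<in> A"
    by (auto simp: \<A>_def)
  then have "compact A" using compact_Int_closed[OF assms(1), of A] by (simp add: Int_absorb1)
  obtain p where p: "p \<in> A" using A by (auto simp: \<A>_def)
  \<comment> \<open>By minimality the closed subsemigroup of all \<open>f \<circ> p\<close> is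
    \<open>A\<close>. So some \<open>h\<close> in \<open>A\<close> satisfies
    \<open>h \<circ> p = p\<close>, which makes the stabiliser of \<open>p\<close> below
    nonempty.\<close>
  have "(\<lambda>f. f \<circ> p) ` A = A"
  proof (rule min)
    have "closed ((\<lambda>f. f \<circ> p) ` A)"
      by (intro compact_imp_closed_fun compact_continuous_image continuous_on_comp_right \<open>compact A\<close>)
    moreover have "(f \<circ> p) \<circ> (g \<circ> p) \<in> (\<lambda>f. f \<circ> p) ` A" if "f \<in> A" "g \<in> A" for f g
      using cl[OF cl[OF that(1) p] that(2)] by (metis comp_assoc image_eqI)
    ultimately show "(\<lambda>f. f \<circ> p) ` A \<in> \<A>"
      using p cl \<open>A \<subseteq> S\<close> by (auto simp: \<A>_def)
  qed (use p cl in auto)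
  then obtain h where "h \<in> A" "h \<circ> p = p" using p by (metis (no_types, lifting) image_iff)
  \<comment> \<open>The stabiliser is again a closed subsemigroup, hence all of \<open>A\<close>;
    membership of \<open>p\<close> itself means \<open>p \<circ> p = p\<close>.\<close>
  moreover have "{f \<in> A. f \<circ> p = p} = A"
  proof (rule min)
    have "closed (A \<inter> (\<lambda>f. f \<circ> p) -` {p})"
      by (intro continuous_closed_preimage continuous_on_comp_right \<open>closed A\<close> compact_imp_closed_fun)
        simp
    moreover have "A \<inter> (\<lambda>f. f \<circ> p) -` {p} = {f \<in> A. f \<circ> p = p}" by auto
    ultimately show "{f \<in> A. f \<circ> p = p} \<in> \<A>"
      using \<open>A \<subseteq> S\<close> cl \<open>h \<in> A\<close> \<open>h \<circ> p = p\<close> by (auto simp: \<A>_def comp_assoc)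
  qed auto
  ultimately show ?thesis using that[of p] p \<open>A \<subseteq> S\<close> by auto
qed

section \<open>Compact semigroups whose idempotents are right identities\<close>

text \<open>Isolates the algebra of a limit set from the dynamics, so that it serves both time
  directions.\<close>

locale compact_semigroup_right_unital =
  fixes S :: "('a::metric_space \<Rightarrow> 'a) set"
  assumes compact: "compact S"
    and closed_comp: "f \<in> S \<Longrightarrow> g \<in> S \<Longrightarrow> f \<circ> g \<in> S"
    and right_unit: "p \<in> S \<Longrightarrow> p \<circ> p = p \<Longrightarrow> f \<in> S \<Longrightarrow> f \<circ> p = f"
begin

text \<open>Left simplicity. The compact subsemigroup of all \<open>g \<circ> f\<close> contains an
  idempotent \<open>p = h \<circ> f\<close>. As \<open>p\<close> is a right identity,
  \<open>s = s \<circ> p = (s \<circ> h) \<circ> f\<close>.\<close>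

lemma left_translates_eq:
  assumes f: "f \<in> S"
  shows "(\<lambda>g. g \<circ> f) ` S = S"
proof
  show "(\<lambda>g. g \<circ> f) ` S \<subseteq> S" using f closed_comp by auto
  have "compact ((\<lambda>g. g \<circ> f) ` S)"
    by (intro compact_continuous_image continuous_on_comp_right compact)
  moreover have "(\<lambda>g. g \<circ> f) ` S \<noteq> {}" using f by auto
  moreover have "u \<circ> v \<in> (\<lambda>g. g \<circ> f) ` S"
    if "u \<in> (\<lambda>g. g \<circ> f) ` S" "v \<in> (\<lambda>g. g \<circ> f) ` S" for u v
  proof -
    obtain g h where gh: "g \<in> S" "h \<in> S" "u = g \<circ> f" "v = h \<circ> f" using \<open>u \<in> _\<close> \<open>v \<in> _\<close> by auto
    then have "u \<circ> v = (g \<circ> f \<circ> h) \<circ> f" by (simp add: comp_assoc)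
    then show ?thesis using closed_comp[OF closed_comp[OF gh(1) f] gh(2)] by blast
  qed
  ultimately obtain p where "p \<in> (\<lambda>g. g \<circ> f) ` S" "p \<circ> p = p"
    by (rule compact_semigroup_idempotent)
  then obtain h where h: "h \<in> S" "h \<circ> f = p" "p \<circ> p = p" by auto
  show "S \<subseteq> (\<lambda>g. g \<circ> f) ` S"
  proof
    fix s assume s: "s \<in> S"
    have "p \<in> S" using h f closed_comp by auto
    then have "s = (s \<circ> h) \<circ> f" using right_unit[OF _ h(3) s] h(2) by (simp add: comp_assoc)
    then show "s \<in> (\<lambda>g. g \<circ> f) ` S" using closed_comp[OF s h(1)] by blast
  qed
qed

text \<open>An idempotent \<open>q\<close> with \<open>q \<circ> f = f\<close> is a two-sided
  identity for \<open>f\<close>, since idempotents are right identities; \<open>f\<close> is then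
  inverted relative to \<open>q\<close>.\<close>

lemma normal_inverse_exists:
  assumes f: "f \<in> S"
  shows "\<exists>t\<in>S. normal_inverse (\<circ>) f t"
proof -
  \<comment> \<open>The left stabiliser of \<open>f\<close>: nonempty by left simplicity, closed
    because right translations are continuous.\<close>
  define T where "T = S \<inter> (\<lambda>g. g \<circ> f) -` {f}"
  have "closed T"
    unfolding T_def
    by (intro continuous_closed_preimage continuous_on_comp_right compact_imp_closed_fun compact) simp
  then have "compact T"
    using compact_Int_closed[OF compact, of T] by (simp add: T_def Int_absorb1)
  moreover have "f \<in> (\<lambda>g. g \<circ> f) ` S" using left_translates_eq[OF f] f by simp
  then have "T \<noteq> {}" by (force simp: T_def)
  moreover have "u \<circ> v \<in> T" if "u \<in> T" "v \<in> T" for u v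
    using that closed_comp by (auto simp: T_def comp_assoc)
  ultimately obtain q where "q \<in> T" and qq: "q \<circ> q = q"
    by (rule compact_semigroup_idempotent)
  then have q: "q \<in> S" "q \<circ> f = f" by (auto simp: T_def)
  obtain h where h: "h \<in> S" "h \<circ> f = q" using left_translates_eq[OF f] q(1) by (metis (no_types, lifting) imageE)
  \<comment> \<open>The factor \<open>q\<close> keeps \<open>t \<circ> f = q\<close> and adds
    \<open>q \<circ> t = t\<close>.\<close>
  define t where "t = q \<circ> h"
  have t: "t \<in> S" using q h closed_comp by (auto simp: t_def)
  have tf: "t \<circ> f = q" using h(2) qq by (simp add: t_def comp_assoc)
  have qt: "q \<circ> t = t" using qq by (simp add: t_def comp_assoc[symmetric])
  have fq: "f \<circ> q = f" by (rule right_unit[OF q(1) qq f])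
  \<comment> \<open>Being idempotent, \<open>f \<circ> t\<close> is a right identity, so
    \<open>q \<circ> (f \<circ> t)\<close> is \<open>q\<close>; by \<open>q \<circ> f = f\<close> it
    is also \<open>f \<circ> t\<close>.\<close>
  have "(f \<circ> t) \<circ> (f \<circ> t) = f \<circ> (t \<circ> f) \<circ> t" by (simp only: comp_assoc)
  also have "\<dots> = f \<circ> t" by (simp only: tf fq)
  finally have "q \<circ> (f \<circ> t) = q"
    by (rule right_unit[OF closed_comp[OF f t] _ q(1)])
  moreover have "q \<circ> (f \<circ> t) = f \<circ> t" by (simp only: comp_assoc[symmetric] q(2))
  ultimately have "f \<circ> t = q" by simp
  then have "normal_inverse (\<circ>) f t"
    by (simp only: normal_inverse_def tf q(2) qt simp_thms)
  then show ?thesis using t by blast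
qed

end

section \<open>Limits of the iterates\<close>

text \<open>The omega-limit set of the sequence of iterates. Cluster points replace limits of
  subsequences, as the function space need not be metrisable. For \<open>inv \<sigma>\<close> these
  are the backward limits.\<close>

definition forward_limits :: "('a::topological_space \<Rightarrow> 'a) \<Rightarrow> ('a \<Rightarrow> 'a) set" where
  "forward_limits \<sigma> = (\<Inter>n. closure ((\<lambda>t. \<sigma> ^^ t) ` {n..}))"

lemma forward_limits_nonempty:
  fixes \<sigma> :: "'a::metric_space \<Rightarrow> 'a"
  assumes "compact (UNIV :: 'a set)"
  shows "forward_limits \<sigma> \<noteq> {}"
proof -
  have "UNIV \<inter> (\<Inter>n. closure ((\<lambda>t. \<sigma> ^^ t) ` {n..})) \<noteq> {}"
  proof (rule compact_imp_fip_image[OF compact_UNIV_fun[OF assms]])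
    fix I :: "nat set" assume "finite I"
    \<comment> \<open>The iterate with the largest index lies in all these tails;
      \<open>insert 0\<close> covers empty \<open>I\<close>.\<close>
    then have "\<sigma> ^^ Max (insert 0 I) \<in> (\<lambda>t. \<sigma> ^^ t) ` {n..}" if "n \<in> I" for n
      using that by auto
    then have "\<sigma> ^^ Max (insert 0 I) \<in> (\<Inter>n\<in>I. closure ((\<lambda>t. \<sigma> ^^ t) ` {n..}))"
      using closure_subset by blast
    then show "UNIV \<inter> (\<Inter>n\<in>I. closure ((\<lambda>t. \<sigma> ^^ t) ` {n..})) \<noteq> {}" by blast
  qed auto
  then show ?thesis by (simp add: forward_limits_def)
qed

lemma acting_group_inv:
  assumes "bij \<sigma>"
  shows "acting_group (inv \<sigma>) = acting_group \<sigma>"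
proof -
  have "int_iterate (inv \<sigma>) t = int_iterate \<sigma> (- t)" for t
    using assms by (auto simp: int_iterate_def inv_inv_eq)
  then show ?thesis
    unfolding acting_group_def by (metis (no_types, lifting) image_cong image_image surj_uminus)
qed

lemma acting_group_eq_Un:
  "acting_group \<sigma> = range (\<lambda>t::nat. \<sigma> ^^ t) \<union> range (\<lambda>t::nat. inv \<sigma> ^^ t)"
proof -
  have "\<sigma> ^^ t = int_iterate \<sigma> (int t)" "inv \<sigma> ^^ t = int_iterate \<sigma> (- int t)" for t
    by (auto simp: int_iterate_def)
  then have "range (\<lambda>t::nat. \<sigma> ^^ t) \<union> range (\<lambda>t::nat. inv \<sigma> ^^ t) \<subseteq> acting_group \<sigma>"
    unfolding acting_group_def by blast
  moreover have "acting_group \<sigma> \<subseteq> range (\<lambda>t::nat. \<sigma> ^^ t) \<union> range (\<lambda>t::nat. inv \<sigma> ^^ t)"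
    by (auto simp: acting_group_def int_iterate_def)
  ultimately show ?thesis by blast
qed

text \<open>A point that is no limit misses the closure of some forward and of some backward tail.
  What remains of the orbit is finite, hence closed, so the point is one of the iterates.\<close>

lemma ellis_decomposition:
  fixes \<sigma> :: "'a::metric_space \<Rightarrow> 'a"
  shows "ellis \<sigma> = forward_limits \<sigma> \<union> forward_limits (inv \<sigma>) \<union> acting_group \<sigma>"
proof
  have "closure ((\<lambda>t. \<tau> ^^ t) ` {0..}) \<subseteq> ellis \<sigma>" if "\<tau> \<in> {\<sigma>, inv \<sigma>}" for \<tau>
    unfolding ellis_def using that by (intro closure_mono) (auto simp: acting_group_eq_Un)
  then have "forward_limits \<tau> \<subseteq> ellis \<sigma>" if "\<tau> \<in> {\<sigma>, inv \<sigma>}" for \<tau>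
    using that unfolding forward_limits_def by blast
  then show "forward_limits \<sigma> \<union> forward_limits (inv \<sigma>) \<union> acting_group \<sigma> \<subseteq> ellis \<sigma>"
    using closure_subset[of "acting_group \<sigma>"] by (auto simp: ellis_def)
next
  have split: "range (\<lambda>t. \<tau> ^^ t) = (\<lambda>t. \<tau> ^^ t) ` {n..} \<union> (\<lambda>t. \<tau> ^^ t) ` {..<n}"
    for \<tau> :: "'a \<Rightarrow> 'a" and n
  proof -
    have "{n..} \<union> {..<n} = UNIV" by auto
    then show ?thesis by (simp only: image_Un[symmetric])
  qed
  have fin: "closure F = F" if "finite F" for F :: "('a \<Rightarrow> 'a) set"
    using that by (simp add: compact_imp_closed_fun finite_imp_compact)
  show "ellis \<sigma> \<subseteq> forward_limits \<sigma> \<union> forward_limits (inv \<sigma>) \<union> acting_group \<sigma>"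
  proof
    fix f assume f: "f \<in> ellis \<sigma>"
    show "f \<in> forward_limits \<sigma> \<union> forward_limits (inv \<sigma>) \<union> acting_group \<sigma>"
    proof (rule ccontr)
      assume "\<not> ?thesis"
      then obtain m n where mn: "f \<notin> closure ((\<lambda>t. \<sigma> ^^ t) ` {m..})"
        "f \<notin> closure ((\<lambda>t. inv \<sigma> ^^ t) ` {n..})" "f \<notin> acting_group \<sigma>"
        by (auto simp: forward_limits_def)
      moreover have "f \<in> closure (((\<lambda>t. \<sigma> ^^ t) ` {m..} \<union> (\<lambda>t. \<sigma> ^^ t) ` {..<m}) \<union>
          ((\<lambda>t. inv \<sigma> ^^ t) ` {n..} \<union> (\<lambda>t. inv \<sigma> ^^ t) ` {..<n}))"
        using f unfolding ellis_def acting_group_eq_Un split[symmetric] .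
      ultimately have "f \<in> (\<lambda>t. \<sigma> ^^ t) ` {..<m} \<union> (\<lambda>t. inv \<sigma> ^^ t) ` {..<n}"
        by (simp add: closure_Un fin)
      then show False using mn(3) by (auto simp: acting_group_eq_Un)
    qed
  qed
qed

section \<open>Ideal properties of the limit sets\<close>

text \<open>A continuous map carrying late iterates to late iterates preserves cluster points. It is
  meant for composition with a group element on either side.\<close>

lemma image_forward_limits:
  assumes "continuous_on UNIV h"
    and tails: "\<And>n. \<exists>k. \<forall>t\<ge>k. \<exists>t'\<ge>n. h (\<sigma> ^^ t) = \<sigma> ^^ t'"
    and f: "f \<in> forward_limits \<sigma>"
  shows "h f \<in> forward_limits \<sigma>"
  unfolding forward_limits_def
proof
  fix n
  obtain k where k: "\<And>t. t \<ge> k \<Longrightarrow> \<exists>t'\<ge>n. h (\<sigma> ^^ t) = \<sigma> ^^ t'" using tails by blast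
  have "h ` closure ((\<lambda>t. \<sigma> ^^ t) ` {k..}) \<subseteq> closure ((\<lambda>t. \<sigma> ^^ t) ` {n..})"
  proof (rule image_closure_subset)
    show "continuous_on (closure ((\<lambda>t. \<sigma> ^^ t) ` {k..})) h"
      using assms(1) by (rule continuous_on_subset) simp
    have "h ` (\<lambda>t. \<sigma> ^^ t) ` {k..} \<subseteq> (\<lambda>t. \<sigma> ^^ t) ` {n..}" using k by force
    then show "h ` (\<lambda>t. \<sigma> ^^ t) ` {k..} \<subseteq> closure ((\<lambda>t. \<sigma> ^^ t) ` {n..})"
      using closure_subset by (rule order_trans)
  qed simp
  then show "h f \<in> closure ((\<lambda>t. \<sigma> ^^ t) ` {n..})"
    using f by (auto simp: forward_limits_def)
qed

lemma int_iterate_comp_funpow: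
  assumes "bij \<sigma>" "s + int t \<ge> 0"
  shows "int_iterate \<sigma> s \<circ> \<sigma> ^^ t = \<sigma> ^^ nat (s + int t)"
    and "\<sigma> ^^ t \<circ> int_iterate \<sigma> s = \<sigma> ^^ nat (s + int t)"
proof -
  have funpow: "\<sigma> ^^ t = int_iterate \<sigma> (int t)" for t by (simp add: int_iterate_def)
  have "int (nat (s + int t)) = s + int t" using assms(2) by simp
  then show "int_iterate \<sigma> s \<circ> \<sigma> ^^ t = \<sigma> ^^ nat (s + int t)"
    and "\<sigma> ^^ t \<circ> int_iterate \<sigma> s = \<sigma> ^^ nat (s + int t)"
    by (simp_all only: funpow int_iterate_add[OF assms(1), symmetric] add.commute[of _ s])
qed

lemma forward_limits_comp_acting_group:
  assumes "homeomorphism UNIV UNIV \<sigma> (inv \<sigma>)" "f \<in> forward_limits \<sigma>" "g \<in> acting_group \<sigma>"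
  shows "g \<circ> f \<in> forward_limits \<sigma>" and "f \<circ> g \<in> forward_limits \<sigma>"
proof -
  obtain s where g: "g = int_iterate \<sigma> s" using assms(3) by (auto simp: acting_group_def)
  note bij = homeomorphism_UNIV_bij[OF assms(1)]
  \<comment> \<open>From \<open>n + nat \<bar>s\<bar>\<close> on, a shift by \<open>s\<close> of
    either sign leaves the exponent at least \<open>n\<close>.\<close>
  have *: "nat (s + int t) \<ge> n" "s + int t \<ge> 0" if "t \<ge> n + nat \<bar>s\<bar>" for t n
    using that by linarith+
  have left: "\<exists>k. \<forall>t\<ge>k. \<exists>t'\<ge>n. g \<circ> \<sigma> ^^ t = \<sigma> ^^ t'" for n
    using * int_iterate_comp_funpow(1)[OF bij] g by metis
  have right: "\<exists>k. \<forall>t\<ge>k. \<exists>t'\<ge>n. \<sigma> ^^ t \<circ> g = \<sigma> ^^ t'" for n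
    using * int_iterate_comp_funpow(2)[OF bij] g by metis
  have "continuous_on UNIV g" unfolding g by (rule continuous_on_int_iterate[OF assms(1)])
  then show "g \<circ> f \<in> forward_limits \<sigma>"
    by (rule image_forward_limits[where h = "\<lambda>f. g \<circ> f", OF continuous_on_comp_left left assms(2)])
  show "f \<circ> g \<in> forward_limits \<sigma>"
    by (rule image_forward_limits[where h = "\<lambda>f. f \<circ> g", OF continuous_on_comp_right right assms(2)])
qed

lemma closed_forward_limits: "closed (forward_limits \<sigma>)"
  by (auto simp: forward_limits_def)

text \<open>\<open>g \<circ> f\<close> is continuous in \<open>g\<close> and the limit set is
  closed, so the case of group elements passes to the closure. In the right factor composition need
  not be continuous.\<close>

lemma ellis_comp_forward_limits:
  assumes "homeomorphism UNIV UNIV \<sigma> (inv \<sigma>)" "g \<in> ellis \<sigma>" "f \<in> forward_limits \<sigma>"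
  shows "g \<circ> f \<in> forward_limits \<sigma>"
proof -
  have "(\<lambda>g. g \<circ> f) ` closure (acting_group \<sigma>) \<subseteq> forward_limits \<sigma>"
    using forward_limits_comp_acting_group(1)[OF assms(1,3)]
    by (intro image_closure_subset continuous_on_comp_right closed_forward_limits) auto
  then show ?thesis using assms(2) by (auto simp: ellis_def)
qed

section \<open>Asymptotic and proximal pairs seen through limits\<close>

text \<open>The closed condition \<open>dist (f x) (f y) \<le> e\<close> holds on a tail of the
  iterates, hence at every cluster point.\<close>

lemma forward_asymptotic_imp_limits_eq:
  assumes "(x, y) \<in> forward_asymptotic \<sigma>" "f \<in> forward_limits \<sigma>"
  shows "f x = f y"
proof -
  have "dist (f x) (f y) \<le> e" if "e > 0" for e
  proof -
    have "\<forall>\<^sub>F t in sequentially. dist ((\<sigma> ^^ t) x) ((\<sigma> ^^ t) y) < e"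
      using assms(1) that by (auto simp: forward_asymptotic_def intro: order_tendstoD)
    then obtain n where n: "\<And>t. t \<ge> n \<Longrightarrow> dist ((\<sigma> ^^ t) x) ((\<sigma> ^^ t) y) < e"
      by (auto simp: eventually_sequentially)
    have "closed {f. dist (f x) (f y) \<le> e}"
      by (intro closed_Collect_le continuous_on_dist continuous_on_product_coordinates
          continuous_on_const)
    then have "closure ((\<lambda>t. \<sigma> ^^ t) ` {n..}) \<subseteq> {f. dist (f x) (f y) \<le> e}"
      using n by (intro closure_minimal) (auto intro: less_imp_le)
    then show ?thesis using assms(2) by (auto simp: forward_limits_def)
  qed
  then have "dist (f x) (f y) \<le> 0" by (rule dense_ge) auto
  then show ?thesis by simp
qed

text \<open>The open condition \<open>dist (f x) (f y) < e\<close> holds at a cluster point, hence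
  at some iterate.\<close>

lemma limits_eq_imp_forward_proximal:
  assumes "f \<in> forward_limits \<sigma>" "f x = f y"
  shows "(x, y) \<in> forward_proximal \<sigma>"
proof -
  let ?d = "\<lambda>t. dist ((\<sigma> ^^ t) x) ((\<sigma> ^^ t) y)"
  have bdd: "bdd_below (range ?d)" by (rule bdd_belowI[of _ 0]) auto
  have "(INF t. ?d t) \<le> e" if "e > 0" for e
  proof -
    have op: "open {f. dist (f x) (f y) < e}"
      by (intro open_Collect_less continuous_on_dist continuous_on_product_coordinates
          continuous_on_const)
    have "f \<in> closure ((\<lambda>t. \<sigma> ^^ t) ` {0..})"
      using assms(1) unfolding forward_limits_def by blast
    moreover have "f \<in> {f. dist (f x) (f y) < e}" using assms(2) that by simp
    ultimately have "{f. dist (f x) (f y) < e} \<inter> closure ((\<lambda>t. \<sigma> ^^ t) ` {0..}) \<noteq> {}" by blast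
    then have "{f. dist (f x) (f y) < e} \<inter> (\<lambda>t. \<sigma> ^^ t) ` {0..} \<noteq> {}"
      by (simp only: open_Int_closure_eq_empty[OF op] not_False_eq_True)
    then obtain t where "?d t < e" by auto
    then show ?thesis using cINF_lower[OF bdd, of t] by simp
  qed
  then have "(INF t. ?d t) \<le> 0" by (rule dense_ge) auto
  moreover have "(INF t. ?d t) \<ge> 0" by (rule cINF_greatest) auto
  ultimately show ?thesis by (simp add: forward_proximal_def)
qed

section \<open>Limit sets, kernel and acting group\<close>

text \<open>Dynamics becomes algebra here: \<open>p (p x) = p x\<close> makes \<open>p x\<close> and
  \<open>x\<close> proximal, hence asymptotic, so every limit agrees on them.\<close>

lemma forward_limits_right_unital:
  fixes \<sigma> :: "'a::metric_space \<Rightarrow> 'a"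
  assumes "compact (UNIV :: 'a set)" "homeomorphism UNIV UNIV \<sigma> (inv \<sigma>)"
    and "forward_proximal \<sigma> \<subseteq> forward_asymptotic \<sigma>"
  shows "compact_semigroup_right_unital (forward_limits \<sigma>)"
proof
  show "compact (forward_limits \<sigma>)"
    using compact_Int_closed[OF compact_UNIV_fun[OF assms(1)] closed_forward_limits] by simp
  show "f \<circ> g \<in> forward_limits \<sigma>" if "f \<in> forward_limits \<sigma>" "g \<in> forward_limits \<sigma>" for f g
    using that ellis_comp_forward_limits[OF assms(2)] ellis_decomposition[of \<sigma>] by blast
  show "f \<circ> p = f" if p: "p \<in> forward_limits \<sigma>" "p \<circ> p = p" and f: "f \<in> forward_limits \<sigma>" for f p
  proof
    fix x
    have "p (p x) = p x" using p(2) by (metis comp_apply)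
    then have "(p x, x) \<in> forward_proximal \<sigma>"
      by (rule limits_eq_imp_forward_proximal[OF p(1)])
    then show "(f \<circ> p) x = f x"
      using forward_asymptotic_imp_limits_eq[OF _ f] assms(3) by auto
  qed
qed

text \<open>For \<open>k\<close> in the kernel and a limit \<open>f\<close>,
  \<open>k \<circ> f\<close> lies in both sets. By left simplicity its left translates are all
  limits, and they stay in the kernel.\<close>

lemma forward_limits_subset_kernel:
  fixes \<sigma> :: "'a::metric_space \<Rightarrow> 'a"
  assumes "compact (UNIV :: 'a set)" "homeomorphism UNIV UNIV \<sigma> (inv \<sigma>)"
    and "forward_proximal \<sigma> \<subseteq> forward_asymptotic \<sigma>"
  shows "forward_limits \<sigma> \<subseteq> semigroup_kernel (ellis \<sigma>) (\<circ>)"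
proof -
  let ?K = "semigroup_kernel (ellis \<sigma>) (\<circ>)"
  interpret compact_semigroup_right_unital "forward_limits \<sigma>"
    by (rule forward_limits_right_unital[OF assms])
  have K: "?K \<noteq> {}" "?K \<subseteq> ellis \<sigma>" "\<And>s i. s \<in> ellis \<sigma> \<Longrightarrow> i \<in> ?K \<Longrightarrow> s \<circ> i \<in> ?K \<and> i \<circ> s \<in> ?K"
    using ellis_kernel(1)[OF assms(1,2)] unfolding two_sided_ideal_def by blast+
  obtain k where k: "k \<in> ?K" using K(1) by blast
  obtain f where f: "f \<in> forward_limits \<sigma>" using forward_limits_nonempty[OF assms(1)] by blast
  have sub: "forward_limits \<sigma> \<subseteq> ellis \<sigma>" using ellis_decomposition[of \<sigma>] by blast
  have "k \<circ> f \<in> forward_limits \<sigma>"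
    using ellis_comp_forward_limits[OF assms(2) _ f] k K(2) by blast
  then have "(\<lambda>g. g \<circ> (k \<circ> f)) ` forward_limits \<sigma> = forward_limits \<sigma>"
    by (rule left_translates_eq)
  moreover have "(\<lambda>g. g \<circ> (k \<circ> f)) ` forward_limits \<sigma> \<subseteq> ?K"
    using K(3) k f sub by blast
  ultimately show ?thesis by simp
qed

text \<open>Some pair of distinct proximal points is asymptotic, so every limit collapses it,
  whereas group elements are injective.\<close>

lemma forward_limits_disjoint_acting_group:
  assumes "bij \<sigma>" "forward_proximal \<sigma> \<subseteq> forward_asymptotic \<sigma>" "forward_proximal \<sigma> \<noteq> Id"
  shows "forward_limits \<sigma> \<inter> acting_group \<sigma> = {}"
proof -
  have "Id \<subseteq> forward_proximal \<sigma>" by (auto simp: forward_proximal_def)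
  then obtain x y where xy: "(x, y) \<in> forward_proximal \<sigma>" "x \<noteq> y" using assms(3) by auto
  have "inj g" if "g \<in> acting_group \<sigma>" for g
    using that assms(1) by (auto simp: acting_group_eq_Un intro!: bij_is_inj bij_fn bij_imp_bij_inv)
  then show ?thesis
    using forward_asymptotic_imp_limits_eq xy assms(2) by (blast dest: injD)
qed

section \<open>Both time directions together\<close>

theorem corollary2p9:
  fixes \<sigma> :: "'a::metric_space \<Rightarrow> 'a"
  assumes "compact (UNIV :: 'a set)"
    and "homeomorphism UNIV UNIV \<sigma> (inv \<sigma>)"
    and "forward_proximal \<sigma> = forward_asymptotic \<sigma>"
    and "backward_proximal \<sigma> = backward_asymptotic \<sigma>"
  shows "completely_regular (ellis \<sigma>) (\<circ>) \<and>
    (forward_proximal \<sigma> \<noteq> Id \<and> backward_proximal \<sigma> \<noteq> Id \<longrightarrow>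
       ellis \<sigma> = semigroup_kernel (ellis \<sigma>) (\<circ>) \<union> acting_group \<sigma> \<and>
       semigroup_kernel (ellis \<sigma>) (\<circ>) \<inter> acting_group \<sigma> = {})"
proof -
  let ?E = "ellis \<sigma>" and ?G = "acting_group \<sigma>" and ?K = "semigroup_kernel (ellis \<sigma>) (\<circ>)"
  let ?L = "forward_limits \<sigma>" and ?M = "forward_limits (inv \<sigma>)"
  note bij = homeomorphism_UNIV_bij[OF assms(2)]
  \<comment> \<open>With the next facts, this transfers every forward lemma to
    \<open>inv \<sigma>\<close>, with the same Ellis semigroup and acting group.\<close>
  have homeo: "homeomorphism UNIV UNIV (inv \<sigma>) (inv (inv \<sigma>))"
    using homeomorphism_symD[OF assms(2)] by (simp add: inv_inv_eq[OF bij])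
  have E_inv: "ellis (inv \<sigma>) = ?E" and G_inv: "acting_group (inv \<sigma>) = ?G"
    by (simp_all add: ellis_def acting_group_inv[OF bij])
  have fwd: "forward_proximal \<sigma> \<subseteq> forward_asymptotic \<sigma>"
    and bwd: "forward_proximal (inv \<sigma>) \<subseteq> forward_asymptotic (inv \<sigma>)"
    using assms(3,4) by (simp_all add: backward_proximal_def backward_asymptotic_def)
  note E = ellis_decomposition[of \<sigma>]
  have "\<exists>t\<in>?E. normal_inverse (\<circ>) f t" if "f \<in> ?E" for f
  proof -
    consider "f \<in> ?L" | "f \<in> ?M" | "f \<in> ?G" using \<open>f \<in> ?E\<close> E by blast
    then show ?thesis
    proof cases
      case 1
      then show ?thesis
        using compact_semigroup_right_unital.normal_inverse_exists
          [OF forward_limits_right_unital[OF assms(1,2) fwd]] E by blast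
    next
      case 2
      then show ?thesis
        using compact_semigroup_right_unital.normal_inverse_exists
          [OF forward_limits_right_unital[OF assms(1) homeo bwd]] E by blast
    next
      case 3
      then obtain t where t: "f = int_iterate \<sigma> t" by (auto simp: acting_group_def)
      have "normal_inverse (\<circ>) f (int_iterate \<sigma> (- t))"
        by (simp add: normal_inverse_def t int_iterate_add[OF bij, symmetric])
      moreover have "int_iterate \<sigma> (- t) \<in> ?E" using E by (auto simp: acting_group_def)
      ultimately show ?thesis by blast
    qed
  qed
  then have "completely_regular ?E (\<circ>)"
    using ellis_semigroup[OF assms(2)] by (simp add: completely_regular_def)
  moreover have "?E = ?K \<union> ?G \<and> ?K \<inter> ?G = {}"
    if "forward_proximal \<sigma> \<noteq> Id" "backward_proximal \<sigma> \<noteq> Id"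
  proof -
    have "g \<circ> f \<in> ?L \<union> ?M \<and> f \<circ> g \<in> ?L \<union> ?M" if "g \<in> ?E" "f \<in> ?L \<union> ?M" for f g
    proof
      have left: "g \<circ> f \<in> ?L \<union> ?M" if "g \<in> ?E" "f \<in> ?L \<union> ?M" for f g
        using that ellis_comp_forward_limits[OF assms(2), of g f]
          ellis_comp_forward_limits[OF homeo, of g f] E_inv by auto
      show "g \<circ> f \<in> ?L \<union> ?M" using that by (rule left)
      \<comment> \<open>For the right factor, \<open>g\<close> is split by the decomposition: if
        \<open>g\<close> is a limit, \<open>f\<close> acts on it from the left; if \<open>g\<close>
        is in the group, it shifts the iterates.\<close>
      have "f \<in> ?E" using \<open>f \<in> ?L \<union> ?M\<close> E by blast
      moreover have "f \<circ> g \<in> ?L \<union> ?M" if "g \<in> ?G"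
        using that \<open>f \<in> ?L \<union> ?M\<close> forward_limits_comp_acting_group(2)[OF assms(2)]
          forward_limits_comp_acting_group(2)[OF homeo] G_inv by blast
      ultimately show "f \<circ> g \<in> ?L \<union> ?M" using left[of f g] \<open>g \<in> ?E\<close> E by blast
    qed
    then have "two_sided_ideal ?E (\<circ>) (?L \<union> ?M)"
      using forward_limits_nonempty[OF assms(1), of \<sigma>] E by (auto simp: two_sided_ideal_def)
    then have "?K \<subseteq> ?L \<union> ?M" by (rule ellis_kernel(2)[OF assms(1,2)])
    moreover have "?L \<union> ?M \<subseteq> ?K"
      using forward_limits_subset_kernel[OF assms(1,2) fwd]
        forward_limits_subset_kernel[OF assms(1) homeo bwd] E_inv by auto
    \<comment> \<open>Non-triviality enters here, once for each time direction.\<close>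
    moreover have "(?L \<union> ?M) \<inter> ?G = {}"
      using forward_limits_disjoint_acting_group[OF bij fwd]
        forward_limits_disjoint_acting_group[OF bij_imp_bij_inv[OF bij] bwd] that G_inv
      by (auto simp: backward_proximal_def)
    ultimately show ?thesis using E by blast
  qed
  ultimately show ?thesis by blast
qed

end
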